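(* Let $G$ be a finite digraph, and let $a,b\in V(G)$ (possibly equal). Put $A=N^+(a)\setminus\{b\}$ and $B=N^-(b)\setminus\{a\}$. Let $H=\operatorname{Ind}(A\setminus B,B\setminus A)$ be the induced digraph from $A\setminus B$ to $B\setminus A$, let $t$ be the number of its connected components (regarding $H$ as an undirected graph), and write these components as $H_1,\dots,H_t$. For each $k\in\{1,\dots,t\}$ let $S_k$ be the set of edges of $G$ that either start in $V(H_k)\setminus B$ and end in $(N^+(a)\cup\{a\})\cap N^-(b)$, or start in $N^+(a)\cap(N^-(b)\cup\{b\})$ and end in $V(H_k)\setminus A$. Then $$\dim\Omega_3^{(a,b)}(G)=\bigl(|E(H)|-|V(H)|+t\bigr)+\Bigl|E\bigl(N^+(a)\cap(N^-(b)\cup\{b\}),\,(N^+(a)\cup\{a\})\cap N^-(b)\bigr)\Bigr|+\sum_{k=1}^t\max\{0,|S_k|-1\}.$$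
   Context: A digraph is a pair $G=(V,E)$ with $E\subset (V\times V)\setminus\mathrm{diag}$; write $i\to j$ if $(i,j)\in E$. $N^+(v)=\{w: v\to w\}$ and $N^-(v)=\{w: w\to v\}$. For $X,Y\subseteq V$, $E(X,Y)=\{(u,v)\in E: u\in X, v\in Y\}$. For disjoint $X,Y\subseteq V$, $\operatorname{Ind}(X,Y)$ is the digraph with vertex set $X\cup Y$ and edge set $E(X,Y)$ (isolated vertices are kept and count as components). Fix a field $\mathbb{K}$. An elementary $p$-path is a sequence $i_0,\dots,i_p$ of vertices (repetitions allowed), written $e_{i_0\dots i_p}$; $\Lambda_p$ is the $\mathbb{K}$-vector space with basis all elementary $p$-paths. The boundary is $\partial e_{i_0\dots i_p}=\sum_{q=0}^p(-1)^q e_{i_0\dots\widehat{i_q}\dots i_p}$. An elementary path is irregular if $i_k=i_{k+1}$ for some $k$; $\mathcal{I}_p$ is the span of irregular ones, $\mathcal{R}_p=\Lambda_p/\mathcal{I}_p$, and $\partial$ descends to $\mathcal{R}_p\to\mathcal{R}_{p-1}$. An elementary path is allowed if $i_k\to i_{k+1}$ for all $k$; $\mathcal{A}_p(G)\subset\mathcal{R}_p$ is the span of allowed elementary $p$-paths, and $\Omega_p(G)=\{u\in\mathcal{A}_p(G):\partial u\in\mathcal{A}_{p-1}(G)\}$. $\Omega_3^{(a,b)}(G)$ is the subspace of those $\omega\in\Omega_3(G)$ all of whose elementary terms with nonzero coefficient start at $a$ and end at $b$. *)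

theory Defs
  imports "HOL.Vector_Spaces" "HOL-Library.Poly_Mapping" "Graph_Theory.Graph_Theory"
begin

section \<open>Digraphs\<close>

text \<open>Finite digraphs without loops are the locale \<open>pair_digraph\<close> on \<open>'a pair_pre_digraph\<close>.\<close>

definition out_nbrs :: "'a pair_pre_digraph \<Rightarrow> 'a \<Rightarrow> 'a set" where
  "out_nbrs G v = {w. (v, w) \<in> parcs G}"

definition in_nbrs :: "'a pair_pre_digraph \<Rightarrow> 'a \<Rightarrow> 'a set" where
  "in_nbrs G v = {w. (w, v) \<in> parcs G}"

definition edges_between :: "'a pair_pre_digraph \<Rightarrow> 'a set \<Rightarrow> 'a set \<Rightarrow> ('a \<times> 'a) set" where
  "edges_between G X Y = {(u, v). (u, v) \<in> parcs G \<and> u \<in> X \<and> v \<in> Y}"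

definition Ind :: "'a pair_pre_digraph \<Rightarrow> 'a set \<Rightarrow> 'a set \<Rightarrow> 'a pair_pre_digraph" where
  "Ind G X Y = \<lparr>pverts = X \<union> Y, parcs = edges_between G X Y\<rparr>"

text \<open>\<^const>\<open>Digraph_Component.connected\<close> is connectedness of the underlying undirected graph
  (and excludes the empty graph), so these are the components of \<open>H\<close> as an undirected graph; an
  isolated vertex is a component.\<close>

definition components :: "'a pair_pre_digraph \<Rightarrow> ('a, 'a \<times> 'a) pre_digraph set" where
  "components H = {C. pre_digraph.max_subgraph (with_proj H) Digraph_Component.connected C}"


section \<open>Paths and their boundary\<close>

text \<open>An elementary \<open>p\<close>-path is a list of \<open>p + 1\<close> vertices. The type \<open>'a list \<Rightarrow>\<^sub>0 'k\<close> is the vector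
  space with basis all lists, that is, the direct sum of the spaces \<open>\<Lambda>\<^sub>p\<close> over all \<open>p\<close>; the empty
  list accounts for one additional summand in degree \<open>-1\<close>. Paths run through all of the type \<open>'a\<close>;
  the vertex set of a digraph enters through the allowed paths.\<close>

definition path_scale :: "'k::field \<Rightarrow> ('b \<Rightarrow>\<^sub>0 'k) \<Rightarrow> ('b \<Rightarrow>\<^sub>0 'k)" where
  "path_scale c u = Poly_Mapping.map ((*) c) u"

lemma lookup_path_scale [simp]:
  "Poly_Mapping.lookup (path_scale c u) x = c * Poly_Mapping.lookup u x"
  by (simp add: path_scale_def Poly_Mapping.map.rep_eq when_def)

global_interpretation path: vector_space path_scale
  by unfold_locales (auto intro!: poly_mapping_eqI simp: lookup_add algebra_simps)

definition elem_path :: "'b \<Rightarrow> ('b \<Rightarrow>\<^sub>0 'k::field)" where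
  "elem_path xs = Poly_Mapping.single xs 1"

definition omit :: "nat \<Rightarrow> 'a list \<Rightarrow> 'a list" where
  "omit q xs = take q xs @ drop (Suc q) xs"

definition elem_boundary :: "'a list \<Rightarrow> ('a list \<Rightarrow>\<^sub>0 'k::field)" where
  "elem_boundary xs = (\<Sum>q<length xs. path_scale ((-1) ^ q) (elem_path (omit q xs)))"

definition path_boundary :: "('a list \<Rightarrow>\<^sub>0 'k::field) \<Rightarrow> ('a list \<Rightarrow>\<^sub>0 'k)" where
  "path_boundary u =
    (\<Sum>xs\<in>Poly_Mapping.keys u. path_scale (Poly_Mapping.lookup u xs) (elem_boundary xs))"

definition irregular :: "'a list \<Rightarrow> bool" where
  "irregular xs \<longleftrightarrow> (\<exists>k. Suc k < length xs \<and> xs ! k = xs ! Suc k)"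

definition irregular_paths :: "('a list \<Rightarrow>\<^sub>0 'k::field) set" where
  "irregular_paths = path.span (elem_path ` {xs. irregular xs})"

lemma path_expand:
  assumes "finite S" "Poly_Mapping.keys u \<subseteq> S"
  shows "u = (\<Sum>xs\<in>S. path_scale (Poly_Mapping.lookup u xs) (elem_path xs))"
proof (rule poly_mapping_eqI)
  fix y
  have "Poly_Mapping.lookup (\<Sum>xs\<in>S. path_scale (Poly_Mapping.lookup u xs) (elem_path xs)) y
      = (\<Sum>xs\<in>S. if xs = y then Poly_Mapping.lookup u xs else 0)"
    by (auto simp: lookup_sum elem_path_def lookup_single when_def intro!: sum.cong)
  also have "\<dots> = Poly_Mapping.lookup u y"
    using assms by (auto simp: sum.delta in_keys_iff)
  finally show "Poly_Mapping.lookup u y = Poly_Mapping.lookup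
      (\<Sum>xs\<in>S. path_scale (Poly_Mapping.lookup u xs) (elem_path xs)) y" by simp
qed

lemma irregular_paths_iff:
  "u \<in> irregular_paths \<longleftrightarrow> (\<forall>xs. \<not> irregular xs \<longrightarrow> Poly_Mapping.lookup u xs = 0)"
proof
  assume "u \<in> irregular_paths"
  then have u: "u \<in> path.span (elem_path ` {xs. irregular xs})"
    by (simp add: irregular_paths_def)
  show "\<forall>xs. \<not> irregular xs \<longrightarrow> Poly_Mapping.lookup u xs = 0"
    using u
  proof (induction rule: path.span_induct_alt)
    case base then show ?case by simp
  next
    case (step c x y) then show ?case
      by (auto simp: lookup_add elem_path_def lookup_single when_def split: if_splits)
  qed
next
  assume *: "\<forall>xs. \<not> irregular xs \<longrightarrow> Poly_Mapping.lookup u xs = 0"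
  have "(\<Sum>xs\<in>Poly_Mapping.keys u. path_scale (Poly_Mapping.lookup u xs) (elem_path xs))
      \<in> irregular_paths"
    unfolding irregular_paths_def
    by (intro path.span_sum path.span_scale path.span_base) (use * in \<open>auto simp: in_keys_iff\<close>)
  then show "u \<in> irregular_paths"
    using path_expand[of "Poly_Mapping.keys u" u] by simp
qed

lemma path_boundary_superset:
  assumes "finite S" "Poly_Mapping.keys u \<subseteq> S"
  shows "path_boundary u = (\<Sum>xs\<in>S. path_scale (Poly_Mapping.lookup u xs) (elem_boundary xs))"
  unfolding path_boundary_def
  by (rule sum.mono_neutral_left) (use assms in \<open>auto simp: in_keys_iff\<close>)

lemma path_boundary_add: "path_boundary (u + v) = path_boundary u + path_boundary v"
proof -
  let ?S = "Poly_Mapping.keys u \<union> Poly_Mapping.keys v"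
  have "Poly_Mapping.keys (u + v) \<subseteq> ?S" by (rule Poly_Mapping.keys_add)
  then show ?thesis
    by (simp add: path_boundary_superset[of ?S] lookup_add path.scale_left_distrib sum.distrib)
qed

lemma path_boundary_scale: "path_boundary (path_scale c u) = path_scale c (path_boundary u)"
proof -
  have "Poly_Mapping.keys (path_scale c u) \<subseteq> Poly_Mapping.keys u"
    by (auto simp: in_keys_iff)
  then show ?thesis
    by (simp add: path_boundary_superset[of "Poly_Mapping.keys u"] path.scale_sum_right)
qed

lemma path_boundary_diff: "path_boundary (u - v) = path_boundary u - path_boundary v"
  using path_boundary_add[of "u - v" v] by (simp add: algebra_simps)

lemma path_boundary_elem: "path_boundary (elem_path xs) = elem_boundary xs"
  by (simp add: path_boundary_def elem_path_def)

lemma length_omit: "q < length xs \<Longrightarrow> length (omit q xs) = length xs - 1"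
  by (simp add: omit_def)

lemma nth_omit:
  "q < length xs \<Longrightarrow> i < length xs - 1 \<Longrightarrow> omit q xs ! i = (if i < q then xs ! i else xs ! Suc i)"
  by (auto simp: omit_def nth_append min_def)

lemma elem_boundary_irregular:
  assumes "irregular xs"
  shows "elem_boundary xs \<in> irregular_paths"
proof -
  obtain k where k: "Suc k < length xs" "xs ! k = xs ! Suc k"
    using assms by (auto simp: irregular_def)
  have eq: "omit (Suc k) xs = omit k xs"
    using k by (intro nth_equalityI) (auto simp: length_omit nth_omit less_Suc_eq)
  have irr: "irregular (omit q xs)" if q: "q < length xs" "q \<noteq> k" "q \<noteq> Suc k" for q
  proof (cases "q < k")
    case True
    then have "Suc (k - 1) < length (omit q xs) \<and> omit q xs ! (k - 1) = omit q xs ! Suc (k - 1)"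
      using k q by (auto simp: length_omit nth_omit)
    then show ?thesis unfolding irregular_def by blast
  next
    case False
    then have "Suc k < length (omit q xs) \<and> omit q xs ! k = omit q xs ! Suc k"
      using k q by (auto simp: length_omit nth_omit)
    then show ?thesis unfolding irregular_def by blast
  qed
  let ?t = "\<lambda>q. path_scale ((-1) ^ q) (elem_path (omit q xs)) :: 'a list \<Rightarrow>\<^sub>0 'b"
  have "elem_boundary xs = ?t k + ?t (Suc k) + sum ?t ({..<length xs} - {k, Suc k})"
    unfolding elem_boundary_def using k
    by (subst sum.subset_diff[of "{k, Suc k}"]) (auto simp: add.commute)
  also have "?t k + ?t (Suc k) = 0"
    by (simp add: eq)
  finally have "elem_boundary xs = sum ?t ({..<length xs} - {k, Suc k})" by simp
  also have "\<dots> \<in> irregular_paths"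
    unfolding irregular_paths_def
    by (intro path.span_sum path.span_scale path.span_base) (auto intro: irr)
  finally show ?thesis .
qed

lemma path_boundary_irregular:
  assumes "u \<in> irregular_paths"
  shows "path_boundary u \<in> irregular_paths"
  unfolding path_boundary_def irregular_paths_def
proof (intro path.span_sum path.span_scale)
  fix xs assume "xs \<in> Poly_Mapping.keys u"
  then have "irregular xs" using assms by (auto simp: irregular_paths_iff in_keys_iff)
  then show "elem_boundary xs \<in> path.span (elem_path ` {xs. irregular xs})"
    using elem_boundary_irregular unfolding irregular_paths_def by blast
qed


section \<open>Regular paths\<close>

definition path_cong :: "('a list \<Rightarrow>\<^sub>0 'k::field) \<Rightarrow> ('a list \<Rightarrow>\<^sub>0 'k) \<Rightarrow> bool" where
  "path_cong u v \<longleftrightarrow> u - v \<in> irregular_paths"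

lemma path_cong_iff:
  "path_cong u v \<longleftrightarrow>
    (\<forall>xs. \<not> irregular xs \<longrightarrow> Poly_Mapping.lookup u xs = Poly_Mapping.lookup v xs)"
  by (simp add: path_cong_def irregular_paths_iff lookup_minus)

text \<open>The quotient of the direct sum of the \<open>\<Lambda>\<^sub>p\<close> by the direct sum of the \<open>\<I>\<^sub>p\<close>, that is, the direct
  sum of the \<open>\<R>\<^sub>p\<close>.\<close>

quotient_type (overloaded) ('a, 'k) regular_path = "'a list \<Rightarrow>\<^sub>0 'k::field" / path_cong
  by (rule equivpI) (auto simp: reflp_def symp_def transp_def path_cong_iff)

instantiation regular_path :: (type, field) ab_group_add
begin

lift_definition zero_regular_path :: "('a, 'b) regular_path" is 0 .

lift_definition plus_regular_path ::
  "('a, 'b) regular_path \<Rightarrow> ('a, 'b) regular_path \<Rightarrow> ('a, 'b) regular_path" is "(+)"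
  by (simp add: path_cong_iff lookup_add)

lift_definition minus_regular_path ::
  "('a, 'b) regular_path \<Rightarrow> ('a, 'b) regular_path \<Rightarrow> ('a, 'b) regular_path" is "(-)"
  by (simp add: path_cong_iff lookup_minus)

lift_definition uminus_regular_path :: "('a, 'b) regular_path \<Rightarrow> ('a, 'b) regular_path" is uminus
  by (simp add: path_cong_iff)

instance
  by standard (transfer; simp add: path_cong_iff lookup_add lookup_minus algebra_simps)+

end

lift_definition regular_scale :: "'k::field \<Rightarrow> ('a, 'k) regular_path \<Rightarrow> ('a, 'k) regular_path"
  is path_scale
  by (simp add: path_cong_iff)

global_interpretation regular: vector_space regular_scale
  by unfold_locales (transfer; simp add: path_cong_iff lookup_add algebra_simps)+

lift_definition regular_elem :: "'a list \<Rightarrow> ('a, 'k::field) regular_path" is elem_path .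

lift_definition regular_boundary :: "('a, 'k::field) regular_path \<Rightarrow> ('a, 'k) regular_path"
  is path_boundary
  unfolding path_cong_def by (metis path_boundary_diff path_boundary_irregular)

text \<open>The classes of the elementary paths that are not irregular form a basis of the quotient; this
  is the coefficient with respect to that basis.\<close>

lift_definition regular_coeff :: "('a, 'k::field) regular_path \<Rightarrow> 'a list \<Rightarrow> 'k"
  is "\<lambda>u xs. if irregular xs then 0 else Poly_Mapping.lookup u xs"
  by (auto simp: path_cong_iff)


section \<open>Allowed and \<open>\<partial>\<close>-invariant paths\<close>

definition allowed :: "'a pair_pre_digraph \<Rightarrow> 'a list \<Rightarrow> bool" where
  "allowed G xs \<longleftrightarrow>
    set xs \<subseteq> pverts G \<and> (\<forall>k. Suc k < length xs \<longrightarrow> (xs ! k, xs ! Suc k) \<in> parcs G)"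

definition allowed_paths :: "'a pair_pre_digraph \<Rightarrow> nat \<Rightarrow> ('a, 'k::field) regular_path set" where
  "allowed_paths G p = regular.span (regular_elem ` {xs. length xs = Suc p \<and> allowed G xs})"

text \<open>In degree \<open>0\<close> the boundary condition is void, so that the summand in degree \<open>-1\<close> plays
  no role.\<close>

definition Omega :: "'a pair_pre_digraph \<Rightarrow> nat \<Rightarrow> ('a, 'k::field) regular_path set" where
  "Omega G p =
    {u \<in> allowed_paths G p. p = 0 \<or> regular_boundary u \<in> allowed_paths G (p - 1)}"

definition Omega_from_to ::
  "'a pair_pre_digraph \<Rightarrow> nat \<Rightarrow> 'a \<Rightarrow> 'a \<Rightarrow> ('a, 'k::field) regular_path set" where
  "Omega_from_to G p a b =
    {w \<in> Omega G p. \<forall>xs. regular_coeff w xs \<noteq> 0 \<longrightarrow> hd xs = a \<and> last xs = b}"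

end

theory Submission
  imports Defs
begin

text \<open>A path in \<open>\<Omega>\<^sub>3\<close> from \<open>a\<close> to \<open>b\<close> is a combination of \<open>e\<^bsub>axyb\<^esub>\<close> over the arcs \<open>(x, y)\<close> from \<open>N\<^sup>+(a)\<close> to
  \<open>N\<^sup>-(b)\<close>. In its boundary only the terms \<open>e\<^bsub>avb\<^esub>\<close> with \<open>v\<close> a vertex of \<open>H\<close> can fail to be allowed, so the
  space is the kernel of the signed incidence map from these arcs to the vertices of \<open>H\<close>. Arcs of
  \<open>H\<close> are sent to \<open>\<delta>\<^sub>x - \<delta>\<^sub>y\<close>, arcs in \<open>S\<^sub>k\<close> to \<open>\<plusminus>\<delta>\<^sub>v\<close> with \<open>v\<close> in the component \<open>H\<^sub>k\<close>, and all others to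
  \<open>0\<close>. The rank of this map is therefore \<open>|V(H)|\<close> minus the number of components with empty \<open>S\<^sub>k\<close>,
  and \<open>|S\<^sub>k| + [S\<^sub>k = \<emptyset>] = 1 + max {0, |S\<^sub>k| - 1}\<close>.\<close>

section \<open>Linear algebra\<close>

text \<open>The coordinates of \<open>x\<close> in the basis \<open>B\<close> are supported both in
  \<open>A\<close> and in \<open>B - A\<close>, hence all vanish.\<close>

lemma (in vector_space) span_Int_Diff_independent:
  assumes "independent B" "A \<subseteq> B" "x \<in> span A" "x \<in> span (B - A)"
  shows "x = 0"
proof -
  have xB: "x \<in> span B"
    using assms(2,3) span_mono by blast
  have 1: "representation B x = representation A x"
    using assms by (intro representation_extend) auto
  have 2: "representation B x = representation (B - A) x"
    using assms by (intro representation_extend) auto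
  have "representation B x v = 0" for v
    using representation_ne_zero[of A x v] representation_ne_zero[of "B - A" x v] 1 2 by fastforce
  then show ?thesis
    using sum_nonzero_representation_eq[OF assms(1) xB] by simp
qed

text \<open>A basis \<open>B\<close> of the kernel is extended to a basis \<open>C\<close> of
  \<open>U\<close>, and \<open>f\<close> carries \<open>C - B\<close> bijectively to a basis of the
  image. Kernel and image are relative to \<open>U\<close> because the ambient path spaces are in
  general infinite-dimensional; \<open>S\<close> makes \<open>U\<close> finite-dimensional.\<close>

lemma (in vector_space_pair) dim_kernel_plus_dim_image:
  assumes f: "Vector_Spaces.linear s1 s2 f" and U: "vs1.subspace U" "U \<subseteq> vs1.span S" "finite S"
  shows "vs1.dim {x \<in> U. f x = 0} + vs2.dim (f ` U) = vs1.dim U"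
proof -
  let ?N = "{x \<in> U. f x = 0}"
  obtain B where B: "B \<subseteq> ?N" "vs1.independent B" "?N \<subseteq> vs1.span B" "card B = vs1.dim ?N"
    by (rule vs1.basis_exists)
  obtain C where C: "B \<subseteq> C" "C \<subseteq> U" "vs1.independent C" "U \<subseteq> vs1.span C"
    using B by (metis (no_types, lifting) mem_Collect_eq subset_eq vs1.maximal_independent_subset_extend)
  have finC: "finite C"
    using vs1.independent_span_bound[OF U(3) C(3)] C(2) U(2) by blast
  have CU: "vs1.span (C - B) \<subseteq> U"
    using C(2) U(1) by (intro vs1.span_minimal) auto
  \<comment> \<open>An element of the span of \<open>C - B\<close> killed by \<open>f\<close> lies
    in \<open>?N\<close>, hence also in the span of \<open>B\<close>, so it is 0.\<close>
  have inj: "inj_on f (vs1.span (C - B))"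
    unfolding linear_inj_on_iff_eq_0[OF f vs1.subspace_span]
    using vs1.span_Int_Diff_independent[OF C(3,1)] CU B(3) by auto
  have ind: "vs2.independent (f ` (C - B))"
    by (rule linear_independent_injective_image[OF f _ inj])
      (use C(3) vs1.independent_mono in blast)
  have "f ` U \<subseteq> vs2.span (f ` C)"
    using C(4) linear_span_image[OF f, of C] by auto
  also have "\<dots> \<subseteq> vs2.span (f ` (C - B))"
  proof (rule vs2.span_minimal[OF _ vs2.subspace_span], rule image_subsetI)
    fix x assume "x \<in> C"
    then show "f x \<in> vs2.span (f ` (C - B))"
      using B(1) vs2.span_zero by (cases "x \<in> B") (auto intro: vs2.span_base)
  qed
  finally have "vs2.dim (f ` U) = card (f ` (C - B))"
    using C(2) ind by (intro vs2.dim_unique) auto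
  also have "\<dots> = card (C - B)"
    by (intro card_image inj_on_subset[OF inj] vs1.span_superset)
  finally have "vs2.dim (f ` U) = vs1.dim U - vs1.dim ?N"
    using B(4) C(1) vs1.basis_card_eq_dim[OF C(2,4,3)] finC
    by (simp add: card_Diff_subset finite_subset)
  moreover have "vs1.dim ?N \<le> vs1.dim U"
    using B(4) vs1.basis_card_eq_dim[OF C(2,4,3)] card_mono[OF finC C(1)] by simp
  ultimately show ?thesis by simp
qed

section \<open>Free vector spaces and their coordinate subspaces\<close>

lemma lookup_elem_path: "Poly_Mapping.lookup (elem_path x) y = (if x = y then 1 else 0)"
  by (simp add: elem_path_def lookup_single when_def)

lemma in_span_elem_path_iff:
  "u \<in> path.span (elem_path ` S) \<longleftrightarrow> Poly_Mapping.keys u \<subseteq> S"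
proof
  assume "u \<in> path.span (elem_path ` S)"
  then have "Poly_Mapping.lookup u x = 0" if "x \<notin> S" for x
    using that
    by (induction rule: path.span_induct_alt) (auto simp: lookup_add lookup_elem_path split: if_splits)
  then show "Poly_Mapping.keys u \<subseteq> S"
    by (auto simp: in_keys_iff)
next
  assume "Poly_Mapping.keys u \<subseteq> S"
  then have "(\<Sum>x\<in>Poly_Mapping.keys u. path_scale (Poly_Mapping.lookup u x) (elem_path x))
      \<in> path.span (elem_path ` S)"
    by (intro path.span_sum path.span_scale path.span_base) auto
  then show "u \<in> path.span (elem_path ` S)"
    using path_expand[of "Poly_Mapping.keys u" u] by simp
qed

lemma inj_elem_path: "inj (elem_path :: 'b \<Rightarrow> 'b \<Rightarrow>\<^sub>0 'k::field)"
  by (rule injI) (metis lookup_elem_path zero_neq_one)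

lemma dim_span_elem_path:
  "path.dim (path.span (elem_path ` S :: ('b \<Rightarrow>\<^sub>0 'k::field) set)) = card S"
proof -
  have "path.independent (elem_path ` S :: ('b \<Rightarrow>\<^sub>0 'k) set)"
    unfolding path.dependent_def
  proof (clarsimp)
    fix x :: 'b
    have "elem_path ` S - {elem_path x} = (elem_path ` (S - {x}) :: ('b \<Rightarrow>\<^sub>0 'k) set)"
      using inj_elem_path by (auto simp: inj_def)
    moreover assume "(elem_path x :: 'b \<Rightarrow>\<^sub>0 'k) \<in> path.span (elem_path ` S - {elem_path x})"
    ultimately show False
      by (simp add: in_span_elem_path_iff) (simp add: elem_path_def)
  qed
  then show ?thesis
    by (subst path.dim_span_eq_card_independent)
      (auto intro: card_image inj_on_subset[OF inj_elem_path])
qed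

section \<open>Coordinates on regular paths\<close>

lemma regular_coeff_add:
  "regular_coeff (u + v) xs = regular_coeff u xs + regular_coeff v xs"
  by transfer (simp add: lookup_add)

lemma regular_coeff_scale: "regular_coeff (regular_scale c u) xs = c * regular_coeff u xs"
  by transfer simp

lemma regular_coeff_zero: "regular_coeff 0 xs = 0"
  by transfer simp

lemma regular_coeff_sum: "regular_coeff (sum f S) xs = (\<Sum>i\<in>S. regular_coeff (f i) xs)"
  by (induction S rule: infinite_finite_induct) (simp_all add: regular_coeff_add regular_coeff_zero)

lemma regular_coeff_elem:
  "regular_coeff (regular_elem xs) ys = (if xs = ys \<and> \<not> irregular xs then 1 else 0)"
  by transfer (auto simp: lookup_elem_path)

lemma regular_eqI: "(\<And>xs. regular_coeff u xs = regular_coeff v xs) \<Longrightarrow> u = v"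
  by transfer (simp add: path_cong_iff; metis)

lemma finite_regular_coeff: "finite {xs. regular_coeff u xs \<noteq> 0}"
  by transfer (rule finite_subset[OF _ finite_keys], auto simp: in_keys_iff)

lemma regular_expand:
  assumes "finite S" "\<And>xs. regular_coeff u xs \<noteq> 0 \<Longrightarrow> xs \<in> S"
  shows "u = (\<Sum>xs\<in>S. regular_scale (regular_coeff u xs) (regular_elem xs))"
proof (rule regular_eqI)
  fix ys
  \<comment> \<open>The class of an irregular list is 0, so both sides of the expansion have to
    vanish at such a list.\<close>
  have "regular_coeff u ys = 0" if "irregular ys"
    using that by transfer simp
  then have "(\<Sum>xs\<in>S. regular_coeff u xs * regular_coeff (regular_elem xs) ys)
      = (\<Sum>xs\<in>S. if xs = ys then regular_coeff u ys else 0)"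
    by (intro sum.cong) (auto simp: regular_coeff_elem)
  then show "regular_coeff u ys
      = regular_coeff (\<Sum>xs\<in>S. regular_scale (regular_coeff u xs) (regular_elem xs)) ys"
    using assms by (auto simp: regular_coeff_sum regular_coeff_scale)
qed

lemma in_span_regular_elem_iff:
  "u \<in> regular.span (regular_elem ` S) \<longleftrightarrow> (\<forall>xs. regular_coeff u xs \<noteq> 0 \<longrightarrow> xs \<in> S)"
proof
  assume "u \<in> regular.span (regular_elem ` S)"
  then show "\<forall>xs. regular_coeff u xs \<noteq> 0 \<longrightarrow> xs \<in> S"
    by (induction rule: regular.span_induct_alt)
      (auto simp: regular_coeff_zero regular_coeff_add regular_coeff_scale regular_coeff_elem
        split: if_splits)
next
  assume *: "\<forall>xs. regular_coeff u xs \<noteq> 0 \<longrightarrow> xs \<in> S"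
  have "(\<Sum>xs | regular_coeff u xs \<noteq> 0. regular_scale (regular_coeff u xs) (regular_elem xs))
      \<in> regular.span (regular_elem ` S)"
    using * by (intro regular.span_sum regular.span_scale regular.span_base) auto
  then show "u \<in> regular.span (regular_elem ` S)"
    using regular_expand[OF finite_regular_coeff, of u u] by simp
qed

text \<open>An irregular list has class 0 and would be counted on the right without adding a
  dimension; the classes of the other lists are separated by their coefficients.\<close>

lemma dim_span_regular_elem:
  assumes "\<And>xs. xs \<in> S \<Longrightarrow> \<not> irregular xs"
  shows "regular.dim (regular.span (regular_elem ` S :: ('a, 'k::field) regular_path set)) = card S"
proof -
  have inj: "inj_on (regular_elem :: 'a list \<Rightarrow> ('a, 'k) regular_path) S"
    by (rule inj_onI) (metis assms regular_coeff_elem zero_neq_one)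
  have "regular.independent (regular_elem ` S :: ('a, 'k) regular_path set)"
    unfolding regular.dependent_def
  proof (clarsimp)
    fix xs assume xs: "xs \<in> S"
    have "regular_elem ` S - {regular_elem xs}
        = (regular_elem ` (S - {xs}) :: ('a, 'k) regular_path set)"
      using inj xs by (auto simp: inj_on_def)
    moreover assume "(regular_elem xs :: ('a, 'k) regular_path)
        \<in> regular.span (regular_elem ` S - {regular_elem xs})"
    ultimately have "\<forall>ys. regular_coeff (regular_elem xs :: ('a, 'k) regular_path) ys \<noteq> 0
        \<longrightarrow> ys \<in> S - {xs}"
      by (simp only: in_span_regular_elem_iff)
    from this[rule_format, of xs] show False
      using assms[OF xs] by (simp add: regular_coeff_elem)
  qed
  then show ?thesis
    by (simp add: regular.dim_span_eq_card_independent card_image inj del: regular.dim_span)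
qed

section \<open>Differences along the fibres of a map\<close>

text \<open>The span is the kernel of the map that sends \<open>v\<close> to its class
  \<open>c v\<close> and kills the classes in \<open>T\<close>; the image is free on the classes
  outside \<open>T\<close>. With \<open>c\<close> the component of a vertex, this yields the rank of
  incidence vectors.\<close>

lemma dim_span_fibre_differences:
  fixes c :: "'v \<Rightarrow> 'c"
  assumes "finite V" "T \<subseteq> c ` V"
  shows "path.dim (path.span ({elem_path u - elem_path v | u v. u \<in> V \<and> v \<in> V \<and> c u = c v}
      \<union> elem_path ` {v \<in> V. c v \<in> T} :: ('v \<Rightarrow>\<^sub>0 'k::field) set)) + card (c ` V - T) = card V"
    (is "path.dim ?W + _ = _")
proof -
  define q :: "'v \<Rightarrow> ('c \<Rightarrow>\<^sub>0 'k)" where "q v = (if c v \<in> T then 0 else elem_path (c v))" for v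
  define L :: "('v \<Rightarrow>\<^sub>0 'k) \<Rightarrow> ('c \<Rightarrow>\<^sub>0 'k)" where
    "L f = (\<Sum>v\<in>V. path_scale (Poly_Mapping.lookup f v) (q v))" for f
  define U :: "('v \<Rightarrow>\<^sub>0 'k) set" where "U = path.span (elem_path ` V)"
  interpret P: vector_space_pair
    "path_scale :: 'k \<Rightarrow> ('v \<Rightarrow>\<^sub>0 'k) \<Rightarrow> _" "path_scale :: 'k \<Rightarrow> ('c \<Rightarrow>\<^sub>0 'k) \<Rightarrow> _" ..
  have lin: "Vector_Spaces.linear path_scale path_scale L"
    unfolding Vector_Spaces.linear_iff
    by (simp add: L_def lookup_add path.scale_left_distrib sum.distrib path.scale_sum_right
      path.vector_space_axioms)
  have L_elem: "L (elem_path v) = q v" if "v \<in> V" for v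
  proof -
    have "L (elem_path v) = (\<Sum>w\<in>V. if w = v then q v else 0)"
      unfolding L_def by (intro sum.cong) (auto simp: lookup_elem_path)
    then show ?thesis using that assms(1) by simp
  qed
  have "L ` U = path.span (q ` V)"
    using P.linear_span_image[OF lin, of "elem_path ` V"] L_elem by (simp add: U_def image_image)
  \<comment> \<open>The map \<open>q\<close> takes the value 0 only if some class lies in
    \<open>T\<close>; inserting 0 on both sides makes the two generating sets equal in either
    case.\<close>
  also have "\<dots> = path.span (insert 0 (q ` V))"
    by (rule path.span_insert_0[symmetric])
  also have "insert 0 (q ` V) = insert 0 (elem_path ` (c ` V - T))"
    by (auto simp: q_def)
  also have "path.span \<dots> = path.span (elem_path ` (c ` V - T))"
    by (rule path.span_insert_0)
  finally have im: "path.dim (L ` U) = card (c ` V - T)"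
    by (simp add: dim_span_elem_path del: path.dim_span)
  have "{f \<in> U. L f = 0} = ?W"
  proof
    have sub: "path.subspace {f \<in> U. L f = 0}"
      using path.subspace_inter[OF path.subspace_span[of "elem_path ` V"]
          P.linear_subspace_kernel[OF lin]]
      unfolding U_def Int_def by (simp only: mem_Collect_eq)
    show "?W \<subseteq> {f \<in> U. L f = 0}"
      by (rule path.span_minimal[OF _ sub])
        (auto simp: U_def path.span_base path.span_diff P.linear_diff[OF lin] L_elem q_def)
  next
    show "{f \<in> U. L f = 0} \<subseteq> ?W"
    proof clarify
      fix f assume f: "f \<in> U" "L f = 0"
      \<comment> \<open>\<open>r\<close> selects a representative in \<open>V\<close> of each class,
        and \<open>\<rho>\<close> below is \<open>q\<close> lifted back along it.\<close>
      define r where "r = inv_into V c"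
      have r: "r (c v) \<in> V" "c (r (c v)) = c v" if "v \<in> V" for v
        using that by (simp_all add: r_def inv_into_into f_inv_into_f)
      define \<rho> :: "'v \<Rightarrow> ('v \<Rightarrow>\<^sub>0 'k)" where
        "\<rho> v = (if c v \<in> T then 0 else elem_path (r (c v)))" for v
      let ?f = "Poly_Mapping.lookup f"
      \<comment> \<open>At a representative \<open>w\<close> the coefficient is that of
        \<open>L f\<close> at \<open>c w\<close>, which is 0; elsewhere no term contributes.\<close>
      have "(\<Sum>v\<in>V. path_scale (?f v) (\<rho> v)) = 0"
      proof (rule poly_mapping_eqI)
        fix w
        show "Poly_Mapping.lookup (\<Sum>v\<in>V. path_scale (?f v) (\<rho> v)) w = Poly_Mapping.lookup 0 w"
        proof (cases "\<exists>v\<in>V. r (c v) = w")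
          case True
          then have w: "r (c v) = w \<longleftrightarrow> c v = c w" if "v \<in> V" for v
            using r that by metis
          have "Poly_Mapping.lookup (\<Sum>v\<in>V. path_scale (?f v) (\<rho> v)) w
              = Poly_Mapping.lookup (L f) (c w)"
            unfolding L_def lookup_sum
            by (intro sum.cong) (auto simp: \<rho>_def q_def lookup_elem_path w)
          then show ?thesis using f by simp
        next
          case False
          then show ?thesis
            by (auto simp: lookup_sum \<rho>_def lookup_elem_path intro!: sum.neutral)
        qed
      qed
      moreover have "f = (\<Sum>v\<in>V. path_scale (?f v) (elem_path v))"
        using f(1) by (intro path_expand assms(1)) (simp add: U_def in_span_elem_path_iff)
      \<comment> \<open>Subtracting the vanishing sum leaves only generators:
        \<open>elem_path v - elem_path (r (c v))\<close> for a class outside \<open>T\<close>, and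
        \<open>elem_path v\<close> for a class in \<open>T\<close>.\<close>
      ultimately have "f = (\<Sum>v\<in>V. path_scale (?f v) (elem_path v - \<rho> v))"
        by (simp add: path.scale_right_diff_distrib sum_subtractf)
      also have "\<dots> \<in> ?W"
        by (intro path.span_sum path.span_scale path.span_base) (use r in \<open>auto simp: \<rho>_def\<close>, metis)
      finally show "f \<in> ?W" .
    qed
  qed
  then show ?thesis
    using P.dim_kernel_plus_dim_image[OF lin, of U "elem_path ` V"] im assms(1)
      dim_span_elem_path[of V, where 'k = 'k]
    by (simp add: U_def)
qed

section \<open>Components and incidence vectors\<close>

text \<open>The component of \<open>v\<close> is induced on the vertices reachable from
  \<open>v\<close> along arcs in either direction. This trades maximal connected subgraphs for the
  fibres of a class map, to which the computation of spans applies.\<close>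

lemma components_class_map:
  assumes "pair_wf_digraph H"
  obtains c where "components H = c ` pverts H"
    and "\<And>C v. C \<in> components H \<Longrightarrow> v \<in> verts C \<longleftrightarrow> v \<in> pverts H \<and> c v = C"
    and "\<And>u v. u \<in> pverts H \<Longrightarrow> v \<in> pverts H \<Longrightarrow> c u = c v \<longleftrightarrow> (u, v) \<in> (symcl (parcs H))\<^sup>*"
proof -
  interpret pair_wf_digraph H by fact
  let ?R = "(symcl (parcs H))\<^sup>*"
  define N where "N v = {w. (v, w) \<in> ?R}" for v
  define c where "c v = with_proj H \<restriction> N v" for v
  have symR: "sym ?R"
    by (intro sym_rtrancl) (auto simp: sym_def symcl_def)
  have N_verts: "N v \<subseteq> pverts H" if "v \<in> pverts H" for v
  proof
    fix w assume "w \<in> N v"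
    then have "(v, w) \<in> ?R" by (simp add: N_def)
    then show "w \<in> pverts H"
      using that by (induction) (auto simp: symcl_def dest: in_arcsD1 in_arcsD2)
  qed
  have N_eq: "N u = N v \<longleftrightarrow> (u, v) \<in> ?R" for u v
    using symR by (auto simp: N_def sym_def intro: rtrancl_trans)
  have wfc: "wf_digraph (c v)" for v
    unfolding c_def by (rule wellformed_induce_subgraph)
  have sub_c: "subgraph (c v) (with_proj H)" if "v \<in> pverts H" for v
    unfolding c_def using subgraph_induce_subgraphI[of "N v"] N_verts[OF that] by simp
  have conn_c: "Digraph_Component.connected (c v)" for v
    unfolding connected_conv
  proof (intro conjI ballI)
    show "verts (c v) \<noteq> {}" by (auto simp: c_def N_def)
  next
    \<comment> \<open>Connectedness asks for walks inside the vertex set; a walk from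
      \<open>v\<close> stays in \<open>N v\<close>, as every vertex on it is reachable from
      \<open>v\<close>.\<close>
    have from_v: "(v, w) \<in> rtrancl_on (N v) (symcl (arcs_ends (c v)))" if "(v, w) \<in> ?R" for w
      using that
    proof (induction)
      case base then show ?case by (simp add: N_def)
    next
      case (step u w)
      have "u \<in> N v" "w \<in> N v"
        using step.hyps by (auto simp: N_def intro: rtrancl_into_rtrancl)
      then have "(u, w) \<in> symcl (arcs_ends (c v))"
        using step.hyps(2) by (force simp: c_def symcl_def arcs_ends_conv)
      then show ?case
        using rtrancl_on_into_rtrancl_on[OF step.IH] \<open>w \<in> N v\<close> by blast
    qed
    have sym: "sym (rtrancl_on (N v) (symcl (arcs_ends (c v))))"
      by (intro rtrancl_on_sym) (auto simp: sym_def symcl_def)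
    fix u w assume "u \<in> verts (c v)" "w \<in> verts (c v)"
    then have "(v, u) \<in> ?R" "(v, w) \<in> ?R" by (auto simp: c_def N_def)
    then show "(u, w) \<in> rtrancl_on (verts (c v)) (symcl (arcs_ends (c v)))"
      using from_v sym by (auto simp: c_def sym_def intro: rtrancl_on_trans)
  qed
  \<comment> \<open>A connected \<open>C\<close> through \<open>v\<close> has only vertices
    reachable from \<open>v\<close>, and its arcs have both ends among them, so it is contained in
    the induced subgraph.\<close>
  have maximal: "subgraph C (c v)"
    if "subgraph C (with_proj H)" "Digraph_Component.connected C" "v \<in> verts C" for C v
  proof -
    have "symcl (arcs_ends C) \<subseteq> symcl (parcs H)"
      using arcs_ends_mono[OF that(1)] by (auto simp: symcl_def)
    then have mono: "(symcl (arcs_ends C))\<^sup>* \<subseteq> ?R"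
      by (rule rtrancl_mono)
    have "verts C \<subseteq> N v"
    proof
      fix w assume "w \<in> verts C"
      then have "(v, w) \<in> rtrancl_on (verts C) (symcl (arcs_ends C))"
        using that(2,3) by (simp add: connected_conv)
      then have "(v, w) \<in> (symcl (arcs_ends C))\<^sup>*"
        by (rule rtrancl_on_rtranclI)
      then show "w \<in> N v"
        using mono by (auto simp: N_def)
    qed
    moreover have "arcs C \<subseteq> {e \<in> parcs H. fst e \<in> verts C \<and> snd e \<in> verts C}"
    proof
      fix e assume e: "e \<in> arcs C"
      have "wf_digraph C" "tail C = fst" "head C = snd" "arcs C \<subseteq> parcs H"
        using that(1) by (auto simp: subgraph_def compatible_def)
      then show "e \<in> {e \<in> parcs H. fst e \<in> verts C \<and> snd e \<in> verts C}"
        using e wf_digraph.tail_in_verts[of C e] wf_digraph.head_in_verts[of C e] by auto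
    qed
    ultimately show ?thesis
      using that(1) wfc[of v] by (auto simp: subgraph_def c_def compatible_def)
  qed
  \<comment> \<open>The relation \<open>compatible\<close> forces equal tail and head maps, so
    mutual inclusion gives equality of the whole records.\<close>
  have antisym: "C = D" if "subgraph C D" "subgraph D C"
    for C D :: "('a, 'a \<times> 'a) pre_digraph"
    using that by (intro pre_digraph.equality) (auto simp: subgraph_def compatible_def)
  have comp: "components H = c ` pverts H"
  proof (intro equalityI subsetI)
    fix C assume "C \<in> components H"
    then have C: "max_subgraph Digraph_Component.connected C" by (simp add: components_def)
    then obtain v where v: "v \<in> verts C"
      unfolding max_subgraph_def connected_conv by blast
    have sC: "subgraph C (with_proj H)" "Digraph_Component.connected C"
      using C by (auto simp: max_subgraph_def)
    then have "v \<in> pverts H"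
      using v by (auto simp: subgraph_def)
    moreover have "C = c v"
      using C maximal[OF sC v] sub_c[OF \<open>v \<in> pverts H\<close>] conn_c[of v]
      unfolding max_subgraph_def by metis
    ultimately show "C \<in> c ` pverts H" by blast
  next
    fix C assume "C \<in> c ` pverts H"
    then obtain v where v: "v \<in> pverts H" "C = c v" by blast
    have "C' = c v" if "subgraph (c v) C'" "subgraph C' (with_proj H)"
      "Digraph_Component.connected C'" for C'
    proof -
      have "v \<in> verts C'"
        using that(1) by (auto simp: subgraph_def c_def N_def)
      then show ?thesis
        using antisym that maximal by blast
    qed
    then show "C \<in> components H"
      using v sub_c conn_c by (auto simp: components_def max_subgraph_def)
  qed
  have c_eq: "c u = c v \<longleftrightarrow> (u, v) \<in> ?R" for u v
    unfolding N_eq[symmetric] by (metis c_def induce_subgraph_verts)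
  show thesis
  proof (rule that[OF comp])
    fix C v assume "C \<in> components H"
    then obtain u where u: "u \<in> pverts H" "C = c u" using comp by blast
    have "v \<in> verts C \<longleftrightarrow> c u = c v"
      unfolding c_eq by (simp add: u c_def N_def)
    moreover have "v \<in> pverts H" if "v \<in> verts C"
      using that N_verts u by (auto simp: c_def)
    ultimately show "v \<in> verts C \<longleftrightarrow> v \<in> pverts H \<and> c v = C"
      using u by auto
  qed (rule c_eq)
qed

text \<open>A vertex carries a linear condition only as a tail in \<open>X\<close> or as a head in \<open>Y\<close>; these vectors are
  the columns of the corresponding signed incidence matrix.\<close>

definition arc_vector :: "'v set \<Rightarrow> 'v set \<Rightarrow> 'v \<times> 'v \<Rightarrow> ('v \<Rightarrow>\<^sub>0 'k::field)" where
  "arc_vector X Y e =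
    (if fst e \<in> X then elem_path (fst e) else 0) - (if snd e \<in> Y then elem_path (snd e) else 0)"

text \<open>Exactly one end of such an arc carries a condition, and this end lies in
  \<open>U\<close>; its arc vector is plus or minus one basis vector. For the vertex set of a
  component these are the arcs in \<open>S\<^sub>k\<close>.\<close>

definition pendant_arcs :: "('v \<times> 'v) set \<Rightarrow> 'v set \<Rightarrow> 'v set \<Rightarrow> 'v set \<Rightarrow> ('v \<times> 'v) set" where
  "pendant_arcs F X Y U =
    {(x, y) \<in> F. x \<in> U \<inter> X \<and> y \<notin> Y} \<union> {(x, y) \<in> F. x \<notin> X \<and> y \<in> U \<inter> Y}"

text \<open>Arcs of \<open>H\<close> yield differences of adjacent vertices, pendant arcs yield
  basis vectors up to sign, and all other arcs yield 0. Their span is the one in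
  \<open>dim_span_fibre_differences\<close> for the component map, with \<open>T\<close> the
  components having a pendant arc; each remaining component lowers the rank by one.\<close>

lemma dim_span_arc_vectors:
  fixes H :: "'v pair_pre_digraph"
  assumes V: "pverts H = X \<union> Y" and E: "parcs H = F \<inter> X \<times> Y" and fin: "finite X" "finite Y"
  shows "path.dim (path.span (arc_vector X Y ` F :: ('v \<Rightarrow>\<^sub>0 'k::field) set))
      + card {C \<in> components H. pendant_arcs F X Y (verts C) = {}} = card (X \<union> Y)"
proof -
  have "pair_wf_digraph H"
    by unfold_locales (auto simp: V E)
  then obtain c where c: "components H = c ` pverts H"
    "\<And>C v. C \<in> components H \<Longrightarrow> v \<in> verts C \<longleftrightarrow> v \<in> pverts H \<and> c v = C"
    "\<And>u v. u \<in> pverts H \<Longrightarrow> v \<in> pverts H \<Longrightarrow> c u = c v \<longleftrightarrow> (u, v) \<in> (symcl (parcs H))\<^sup>*"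
    by (rule components_class_map) blast
  define T where "T = {C \<in> components H. pendant_arcs F X Y (verts C) \<noteq> {}}"
  let ?g = "arc_vector X Y :: _ \<Rightarrow> ('v \<Rightarrow>\<^sub>0 'k)"
  let ?S = "path.span (?g ` F)"
  let ?D = "{elem_path u - elem_path v | u v. u \<in> pverts H \<and> v \<in> pverts H \<and> c u = c v}
    \<union> elem_path ` {v \<in> pverts H. c v \<in> T} :: ('v \<Rightarrow>\<^sub>0 'k) set"
  \<comment> \<open>Differences telescope along an undirected walk; an arc traversed backwards
    contributes the negative of its vector.\<close>
  have diff_S: "elem_path u - elem_path v \<in> ?S" if "(u, v) \<in> (symcl (parcs H))\<^sup>*" for u v
    using that
  proof induction
    case base show ?case by (simp add: path.span_zero)
  next
    case (step v w)
    have "elem_path x - elem_path y \<in> ?S" if "(x, y) \<in> parcs H" for x y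
      using that by (intro path.span_base image_eqI[of _ _ "(x, y)"]) (auto simp: E arc_vector_def)
    moreover have "(v, w) \<in> parcs H \<or> (w, v) \<in> parcs H"
      using step.hyps(2) by (auto simp: symcl_def)
    ultimately have "elem_path v - elem_path w \<in> ?S"
      using path.span_neg[of "elem_path w - elem_path v" "?g ` F"] by auto
    then show ?case
      using path.span_add[OF step.IH] by fastforce
  qed
  have "?S = path.span ?D"
  proof (rule path.span_eq[THEN iffD2], intro conjI)
    show "?g ` F \<subseteq> path.span ?D"
    proof (clarify)
      fix x y assume e: "(x, y) \<in> F"
      have cD: "elem_path v \<in> path.span ?D"
        if "v \<in> pverts H" "(x, y) \<in> pendant_arcs F X Y (verts (c v))" for v
        using that c(1) by (intro path.span_base) (auto simp: T_def)
      have cv: "v \<in> verts (c v)" if "v \<in> pverts H" for v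
        using c(1,2) that by blast
      have cxy: "c x = c y" if "x \<in> X" "y \<in> Y"
        using c(3)[of x y] that e by (auto simp: V E symcl_def)
      consider "x \<in> X" "y \<in> Y" | "x \<in> X" "y \<notin> Y" | "x \<notin> X" "y \<in> Y" | "x \<notin> X" "y \<notin> Y"
        by blast
      then show "?g (x, y) \<in> path.span ?D"
      proof cases
        case 1
        then show ?thesis
          using cxy by (intro path.span_base) (auto simp: arc_vector_def V)
      next
        case 2
        then show ?thesis
          using cD[of x] cv[of x] e by (simp add: arc_vector_def pendant_arcs_def V)
      next
        case 3
        then show ?thesis
          using cD[of y] cv[of y] e by (simp add: arc_vector_def pendant_arcs_def V path.span_neg)
      next
        case 4
        then show ?thesis by (simp add: arc_vector_def path.span_zero)
      qed
    qed
  next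
    \<comment> \<open>A pendant arc gives the basis vector of its end \<open>u\<close> in the
      component, and adding the difference of \<open>v\<close> and \<open>u\<close> moves it to
      \<open>v\<close>.\<close>
    have "elem_path v \<in> ?S" if v: "v \<in> pverts H" "c v \<in> T" for v
    proof -
      obtain x y where xy: "(x, y) \<in> pendant_arcs F X Y (verts (c v))" "(x, y) \<in> F"
        using v(2) by (auto simp: T_def pendant_arcs_def)
      have g: "?g (x, y) \<in> ?S"
        using xy(2) by (intro path.span_base) auto
      consider "x \<in> verts (c v)" "x \<in> X" "y \<notin> Y" | "y \<in> verts (c v)" "y \<in> Y" "x \<notin> X"
        using xy(1) by (auto simp: pendant_arcs_def)
      then obtain u where u: "u \<in> verts (c v)" "elem_path u \<in> ?S"
      proof cases
        case 1
        then show thesis using g that[of x] by (simp add: arc_vector_def)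
      next
        case 2
        then show thesis
          using path.span_neg[OF g] that[of y] by (simp add: arc_vector_def)
      qed
      have "elem_path v - elem_path u \<in> ?S"
        using u(1) v c by (intro diff_S) (metis imageI)
      then show ?thesis
        using path.span_add[OF _ u(2)] by fastforce
    qed
    then show "?D \<subseteq> ?S"
      using c(3) diff_S by auto
  qed
  moreover have "{C \<in> components H. pendant_arcs F X Y (verts C) = {}} = c ` pverts H - T"
    using c(1) by (auto simp: T_def)
  moreover have "path.dim (path.span ?D) + card (c ` pverts H - T) = card (pverts H)"
    by (rule dim_span_fibre_differences) (use fin c(1) in \<open>auto simp: V T_def\<close>)
  ultimately show ?thesis
    by (simp add: V del: path.dim_span)
qed

text \<open>The arcs in \<open>F\<close> are sorted by the number of ends carrying a condition: two
  for the arcs of \<open>H\<close>, then none, then one. The last kind is divided further by the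
  component containing that end.\<close>

lemma card_arcs_by_components:
  assumes V: "pverts H = X \<union> Y" and E: "parcs H = F \<inter> X \<times> Y"
    and fin: "finite X" "finite Y" "finite F"
  shows "card F = card (parcs H) + card (F \<inter> (- X) \<times> (- Y))
      + (\<Sum>C\<in>components H. card (pendant_arcs F X Y (verts C)))"
    and "finite (components H)"
proof -
  have "pair_wf_digraph H"
    by unfold_locales (auto simp: V E)
  then obtain c where c: "components H = c ` pverts H"
    "\<And>C v. C \<in> components H \<Longrightarrow> v \<in> verts C \<longleftrightarrow> v \<in> pverts H \<and> c v = C"
    by (rule components_class_map) blast
  show fin': "finite (components H)"
    using c(1) fin by (simp add: V)
  let ?P = "\<lambda>C. pendant_arcs F X Y (verts C)"
  have "F = parcs H \<union> F \<inter> (- X) \<times> (- Y) \<union> (\<Union>C\<in>components H. ?P C)"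
    using c by (auto simp: V E pendant_arcs_def)
  moreover have "card (parcs H \<union> F \<inter> (- X) \<times> (- Y) \<union> (\<Union>C\<in>components H. ?P C))
      = card (parcs H) + card (F \<inter> (- X) \<times> (- Y)) + card (\<Union>C\<in>components H. ?P C)"
    using fin
    by (subst card_Un_disjoint card_Un_disjoint[of "parcs H"];
        (auto simp: E pendant_arcs_def intro: finite_subset[of _ F])?)+
  \<comment> \<open>A pendant arc has a single end carrying a condition, and this end lies in only
    one component, so the union is disjoint.\<close>
  moreover have "card (\<Union>C\<in>components H. ?P C) = (\<Sum>C\<in>components H. card (?P C))"
    using fin' fin(3) c(2)
    by (intro card_UN_disjoint) (auto simp: pendant_arcs_def intro: finite_subset[of _ F])
  ultimately show "card F = card (parcs H) + card (F \<inter> (- X) \<times> (- Y))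
      + (\<Sum>C\<in>components H. card (?P C))"
    by simp
qed

section \<open>\<open>\<partial>\<close>-invariant 3-paths\<close>

lemma irregular_simps:
  "\<not> irregular [u]" "irregular (u # v # xs) \<longleftrightarrow> u = v \<or> irregular (v # xs)"
proof -
  show "irregular (u # v # xs) \<longleftrightarrow> u = v \<or> irregular (v # xs)"
  proof
    assume "irregular (u # v # xs)"
    then show "u = v \<or> irregular (v # xs)"
      by (auto simp: irregular_def nth_Cons split: nat.splits)
  next
    assume "u = v \<or> irregular (v # xs)"
    then show "irregular (u # v # xs)"
      unfolding irregular_def by (force intro: exI[of _ 0] exI[of _ "Suc k" for k])
  qed
qed (auto simp: irregular_def)

lemma allowed_simps:
  "allowed G [u] \<longleftrightarrow> u \<in> pverts G"
  "allowed G (u # v # xs) \<longleftrightarrow> u \<in> pverts G \<and> (u, v) \<in> parcs G \<and> allowed G (v # xs)"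
proof -
  have "(\<forall>k. Suc k < length (u # v # xs) \<longrightarrow> ((u # v # xs) ! k, (u # v # xs) ! Suc k) \<in> parcs G)
      \<longleftrightarrow> (u, v) \<in> parcs G \<and>
        (\<forall>k. Suc k < length (v # xs) \<longrightarrow> ((v # xs) ! k, (v # xs) ! Suc k) \<in> parcs G)"
    by (auto simp: nth_Cons split: nat.splits)
  then show "allowed G (u # v # xs) \<longleftrightarrow> u \<in> pverts G \<and> (u, v) \<in> parcs G \<and> allowed G (v # xs)"
    unfolding allowed_def by auto
qed (auto simp: allowed_def)

lemma in_allowed_paths_iff:
  "u \<in> allowed_paths G p \<longleftrightarrow>
    (\<forall>xs. regular_coeff u xs \<noteq> 0 \<longrightarrow> length xs = Suc p \<and> allowed G xs)"
  by (simp add: allowed_paths_def in_span_regular_elem_iff)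

lemma regular_boundary_add: "regular_boundary (u + v) = regular_boundary u + regular_boundary v"
  by transfer (simp add: path_boundary_add path_cong_iff)

lemma regular_boundary_scale:
  "regular_boundary (regular_scale c u) = regular_scale c (regular_boundary u)"
  by transfer (simp add: path_boundary_scale path_cong_iff)

lemma regular_boundary_zero: "regular_boundary 0 = 0"
  using regular_boundary_add[of 0 0] by simp

lemma regular_boundary_sum: "regular_boundary (sum f S) = (\<Sum>i\<in>S. regular_boundary (f i))"
  by (induction S rule: infinite_finite_induct)
    (simp_all add: regular_boundary_add regular_boundary_zero)

lemma regular_coeff_boundary_elem:
  "regular_coeff (regular_boundary (regular_elem xs)) ys =
    (if irregular ys then 0 else \<Sum>q<length xs. if omit q xs = ys then (-1) ^ q else 0)"
  by transfer
    (auto simp: path_boundary_elem elem_boundary_def lookup_sum lookup_elem_path intro!: sum.cong)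

text \<open>Irregular faces vanish in the quotient, hence the restriction on \<open>ys\<close>.
  Adding separate indicators keeps the formula correct when faces coincide.\<close>

lemma regular_coeff_boundary_3_path:
  assumes "\<not> irregular ys"
  shows "regular_coeff (regular_boundary (regular_elem [a, x, y, b])) ys =
    (if ys = [x, y, b] then 1 else 0) - (if ys = [a, y, b] then 1 else 0)
    + (if ys = [a, x, b] then 1 else 0) - (if ys = [a, x, y] then 1 else 0)"
proof -
  have 4: "{..<length [a, x, y, b]} = {0, 1, 2, 3}"
    by auto
  have "omit 0 [a, x, y, b] = [x, y, b]" "omit 1 [a, x, y, b] = [a, y, b]"
    "omit 2 [a, x, y, b] = [a, x, b]" "omit 3 [a, x, y, b] = [a, x, y]"
    by (simp_all add: omit_def)
  then show ?thesis
    using assms unfolding regular_coeff_boundary_elem 4 by auto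
qed

text \<open>For an arc \<open>(x, y)\<close> in \<open>F\<close> the faces \<open>[x, y, b]\<close>
  and \<open>[a, x, y]\<close> are allowed. The face \<open>[a, x, b]\<close> is nonzero and not
  allowed exactly if \<open>x \<in> X\<close>, and \<open>[a, y, b]\<close> exactly if
  \<open>y \<in> Y\<close>; the cases \<open>x = b\<close> and \<open>y = a\<close> are excluded
  since the face is then irregular. \<open>D\<close> collects the coefficients at these faces, and
  the formula is rank-nullity for \<open>D\<close>.\<close>

lemma dim_Omega_3_from_to:
  fixes G :: "'a pair_pre_digraph"
  assumes "pair_digraph G" and "a \<in> pverts G" and "b \<in> pverts G"
  defines "X \<equiv> out_nbrs G a - (in_nbrs G b \<union> {b})"
    and "Y \<equiv> in_nbrs G b - (out_nbrs G a \<union> {a})"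
    and "F \<equiv> edges_between G (out_nbrs G a) (in_nbrs G b)"
  shows "regular.dim (Omega_from_to G 3 a b :: ('a, 'k::field) regular_path set)
      + path.dim (path.span (arc_vector X Y ` F :: ('a \<Rightarrow>\<^sub>0 'k) set)) = card F"
proof -
  interpret pair_digraph G by fact
  have loop: "(v, v) \<notin> parcs G" for v
    using pair_no_loops[of "(v, v)"] by auto
  have finF: "finite F"
    using pair_finite_arcs by (rule finite_subset[rotated]) (auto simp: F_def edges_between_def)
  have F: "(x, y) \<in> F \<longleftrightarrow> (a, x) \<in> parcs G \<and> (x, y) \<in> parcs G \<and> (y, b) \<in> parcs G" for x y
    by (auto simp: F_def edges_between_def out_nbrs_def in_nbrs_def)
  define path where "path = (\<lambda>(x, y). [a, x, y, b])"
  have inj: "inj_on path F"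
    by (auto simp: path_def inj_on_def)
  have path_iff: "xs \<in> path ` F \<longleftrightarrow> length xs = 4 \<and> allowed G xs \<and> hd xs = a \<and> last xs = b" for xs
  proof
    assume "length xs = 4 \<and> allowed G xs \<and> hd xs = a \<and> last xs = b"
    moreover from this obtain x y where "xs = [a, x, y, b]"
      by (auto simp: numeral_eq_Suc length_Suc_conv)
    ultimately show "xs \<in> path ` F"
      by (auto simp: path_def F allowed_simps intro!: image_eqI[of _ _ "(x, y)"])
  qed (auto simp: path_def F allowed_simps dest: in_arcsD1 in_arcsD2)
  define U :: "('a, 'k) regular_path set" where "U = regular.span (regular_elem ` path ` F)"
  define D :: "('a, 'k) regular_path \<Rightarrow> ('a \<Rightarrow>\<^sub>0 'k)" where
    "D w = (\<Sum>e\<in>F. path_scale (regular_coeff w (path e)) (arc_vector X Y e))" for w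
  interpret P: vector_space_pair "regular_scale :: 'k \<Rightarrow> ('a, 'k) regular_path \<Rightarrow> _"
    "path_scale :: 'k \<Rightarrow> ('a \<Rightarrow>\<^sub>0 'k) \<Rightarrow> _" ..
  have lin: "Vector_Spaces.linear regular_scale path_scale D"
    unfolding Vector_Spaces.linear_iff
    by (simp add: D_def regular_coeff_add regular_coeff_scale path.scale_left_distrib sum.distrib
      path.scale_sum_right path.vector_space_axioms regular.vector_space_axioms)
  have regular_F: "\<not> irregular (path e)" if "e \<in> F" for e
    using that loop by (cases e) (auto simp: path_def F irregular_simps)
  have D_elem: "D (regular_elem (path e)) = arc_vector X Y e" if "e \<in> F" for e
  proof -
    have "D (regular_elem (path e)) = (\<Sum>e'\<in>F. if e' = e then arc_vector X Y e else 0)"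
      unfolding D_def using that regular_F inj
      by (intro sum.cong) (auto simp: regular_coeff_elem inj_on_def)
    then show ?thesis using that finF by simp
  qed
  have boundary: "regular_coeff (regular_boundary w) ys =
      (\<Sum>(x, y)\<in>F. regular_coeff w (path (x, y)) *
      ((if ys = [x, y, b] then 1 else 0) - (if ys = [a, y, b] then 1 else 0)
        + (if ys = [a, x, b] then 1 else 0) - (if ys = [a, x, y] then 1 else 0)))"
    if w: "w \<in> U" and ys: "\<not> irregular ys" for w ys
  proof -
    have "w = (\<Sum>xs\<in>path ` F. regular_scale (regular_coeff w xs) (regular_elem xs))"
      using w finF by (intro regular_expand) (auto simp: U_def in_span_regular_elem_iff)
    also have "\<dots> = (\<Sum>e\<in>F. regular_scale (regular_coeff w (path e)) (regular_elem (path e)))"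
      using inj by (simp add: sum.reindex)
    finally have w_eq:
      "w = (\<Sum>e\<in>F. regular_scale (regular_coeff w (path e)) (regular_elem (path e)))" .
    have "regular_coeff (regular_boundary w) ys = (\<Sum>e\<in>F. regular_coeff w (path e) *
        regular_coeff (regular_boundary (regular_elem (path e))) ys)"
      using arg_cong[OF w_eq, of "\<lambda>u. regular_coeff (regular_boundary u) ys"]
      by (simp only: regular_boundary_sum regular_boundary_scale regular_coeff_sum
        regular_coeff_scale)
    also have "\<dots> = (\<Sum>(x, y)\<in>F. regular_coeff w (path (x, y)) *
      ((if ys = [x, y, b] then 1 else 0) - (if ys = [a, y, b] then 1 else 0)
        + (if ys = [a, x, b] then 1 else 0) - (if ys = [a, x, y] then 1 else 0)))"
      by (intro sum.cong refl)
        (simp only: path_def split_beta fst_conv snd_conv regular_coeff_boundary_3_path[OF ys])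
    finally show ?thesis .
  qed
  \<comment> \<open>\<open>[a, v, b]\<close> is never allowed for \<open>v \<in> X \<union> Y\<close>, and the terms \<open>[x, y, b]\<close>, \<open>[a, x, y]\<close> of the
    boundary never hit it.\<close>
  have lookup_D: "Poly_Mapping.lookup (D w) v =
      (if v \<in> X \<union> Y then regular_coeff (regular_boundary w) [a, v, b] else 0)"
    if w: "w \<in> U" for w v
  proof (cases "v \<in> X \<union> Y")
    case True
    then have "\<not> irregular [a, v, b]"
      using loop by (auto simp: X_def Y_def irregular_simps out_nbrs_def in_nbrs_def)
    \<comment> \<open>A vertex in \<open>X\<close> is never the head of an arc in \<open>F\<close>,
      and one in \<open>Y\<close> never the tail, so the two middle indicators match the two parts
      of \<open>arc_vector\<close>.\<close>
    then have "regular_coeff (regular_boundary w) [a, v, b] = Poly_Mapping.lookup (D w) v"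
      unfolding D_def lookup_sum using True loop
      by (subst boundary[OF w])
        (auto intro!: sum.cong simp: arc_vector_def lookup_elem_path lookup_minus F X_def Y_def
          out_nbrs_def in_nbrs_def)
    then show ?thesis using True by simp
  next
    case False
    then show ?thesis
      unfolding D_def lookup_sum
      by (auto intro!: sum.neutral simp: arc_vector_def lookup_elem_path lookup_minus)
  qed
  have "Omega_from_to G 3 a b = {w \<in> U. D w = 0}"
  proof -
    have "(\<forall>ys. regular_coeff (regular_boundary w) ys \<noteq> 0 \<longrightarrow> length ys = 3 \<and> allowed G ys)
        \<longleftrightarrow> D w = 0" if w: "w \<in> U" for w
    proof
      assume *: "\<forall>ys. regular_coeff (regular_boundary w) ys \<noteq> 0 \<longrightarrow> length ys = 3 \<and> allowed G ys"
      show "D w = 0"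
      proof (rule poly_mapping_eqI)
        fix v
        have "\<not> allowed G [a, v, b]" if "v \<in> X \<union> Y"
          using that by (auto simp: allowed_simps X_def Y_def out_nbrs_def in_nbrs_def)
        then show "Poly_Mapping.lookup (D w) v = Poly_Mapping.lookup 0 v"
          using * by (auto simp: lookup_D[OF w])
      qed
    next
      assume D: "D w = 0"
      show "\<forall>ys. regular_coeff (regular_boundary w) ys \<noteq> 0 \<longrightarrow> length ys = 3 \<and> allowed G ys"
      proof (intro allI impI)
        fix ys assume nz: "regular_coeff (regular_boundary w) ys \<noteq> 0"
        then have reg: "\<not> irregular ys"
          by transfer (auto split: if_splits)
        \<comment> \<open>Every boundary term is a face of some path over \<open>F\<close>. The
          faces \<open>[x, y, b]\<close> and \<open>[a, x, y]\<close> are always allowed; the other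
          two are handled through \<open>D w = 0\<close>.\<close>
        obtain x y where xy: "(x, y) \<in> F"
          "ys = [x, y, b] \<or> ys = [a, y, b] \<or> ys = [a, x, b] \<or> ys = [a, x, y]"
          using nz unfolding boundary[OF w reg]
          by (elim sum.not_neutral_contains_not_neutral) (auto split: if_splits)
        have XY: "regular_coeff (regular_boundary w) [a, v, b] = 0" if "v \<in> X \<union> Y" for v
          using D that lookup_D[OF w, of v] by simp
        from xy(2) show "length ys = 3 \<and> allowed G ys"
        proof (elim disjE)
          assume ys: "ys = [a, y, b]"
          \<comment> \<open>If \<open>y\<close> were in \<open>Y\<close>, the coefficient would be
            0, and \<open>y = a\<close> would make the face irregular; what remains is an arc from
            \<open>a\<close> to \<open>y\<close>.\<close>
          then have "y \<notin> Y" "y \<noteq> a"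
            using nz XY reg by (auto simp: irregular_simps)
          then show ?thesis
            using xy(1) ys assms(2,3)
            by (auto simp: F Y_def allowed_simps out_nbrs_def in_nbrs_def dest: in_arcsD1)
        next
          assume ys: "ys = [a, x, b]"
          then have "x \<notin> X" "x \<noteq> b"
            using nz XY reg by (auto simp: irregular_simps)
          then show ?thesis
            using xy(1) ys assms(2,3)
            by (auto simp: F X_def allowed_simps out_nbrs_def in_nbrs_def dest: in_arcsD1)
        qed (use xy(1) in \<open>auto simp: F allowed_simps dest: in_arcsD1 in_arcsD2\<close>)
      qed
    qed
    moreover have "w \<in> U \<longleftrightarrow> (\<forall>xs. regular_coeff w xs \<noteq> 0 \<longrightarrow> length xs = 4 \<and> allowed G xs) \<and>
        (\<forall>xs. regular_coeff w xs \<noteq> 0 \<longrightarrow> hd xs = a \<and> last xs = b)" for w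
      unfolding U_def in_span_regular_elem_iff path_iff by blast
    ultimately show ?thesis
      by (auto simp: Omega_from_to_def Omega_def in_allowed_paths_iff numeral_eq_Suc)
  qed
  moreover have "D ` U = path.span (arc_vector X Y ` F)"
    using P.linear_span_image[OF lin, of "regular_elem ` path ` F"] D_elem
    by (simp add: U_def image_image)
  moreover have "regular.dim U = card F"
    unfolding U_def card_image[OF inj, symmetric]
    by (rule dim_span_regular_elem) (use regular_F in blast)
  ultimately show ?thesis
    using P.dim_kernel_plus_dim_image[OF lin, of U "regular_elem ` path ` F"] finF
    by (simp add: U_def del: path.dim_span regular.dim_span)
qed

section \<open>Counting arcs and components\<close>

theorem theorem4p2:
  fixes G H :: "'a pair_pre_digraph" and a b :: 'a and A B :: "'a set" and t :: nat
    and S :: "('a, 'a \<times> 'a) pre_digraph \<Rightarrow> ('a \<times> 'a) set"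
  assumes "pair_digraph G" and "a \<in> pverts G" and "b \<in> pverts G"
    and "A = out_nbrs G a - {b}" and "B = in_nbrs G b - {a}"
    and "H = Ind G (A - B) (B - A)" and "t = card (components H)"
    and "\<And>C. C \<in> components H \<Longrightarrow> S C =
      edges_between G (verts C - B) ((out_nbrs G a \<union> {a}) \<inter> in_nbrs G b)
      \<union> edges_between G (out_nbrs G a \<inter> (in_nbrs G b \<union> {b})) (verts C - A)"
  shows "int (regular.dim (Omega_from_to G 3 a b :: ('a, 'k::field) regular_path set)) =
    (int (card (parcs H)) - int (card (pverts H)) + int t)
    + int (card (edges_between G (out_nbrs G a \<inter> (in_nbrs G b \<union> {b}))
        ((out_nbrs G a \<union> {a}) \<inter> in_nbrs G b)))
    + (\<Sum>C\<in>components H. max 0 (int (card (S C)) - 1))"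
proof -
  interpret pair_digraph G by fact
  let ?F = "edges_between G (out_nbrs G a) (in_nbrs G b)"
  let ?X = "out_nbrs G a - (in_nbrs G b \<union> {b})" and ?Y = "in_nbrs G b - (out_nbrs G a \<union> {a})"
  let ?P = "\<lambda>C. pendant_arcs ?F ?X ?Y (verts C)"
  have ab: "a \<notin> out_nbrs G a" "b \<notin> in_nbrs G b"
    using pair_no_loops by (force simp: out_nbrs_def in_nbrs_def)+
  \<comment> \<open>The two descriptions could differ only at \<open>a\<close> and \<open>b\<close>,
    where the absence of loops decides.\<close>
  have X: "A - B = ?X" and Y: "B - A = ?Y"
    using ab by (auto simp: assms(4,5))
  have V: "pverts H = ?X \<union> ?Y"
    by (simp only: assms(6) Ind_def X Y pair_pre_digraph.simps)
  have E: "parcs H = ?F \<inter> ?X \<times> ?Y"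
    by (auto simp: assms(6) Ind_def X Y edges_between_def)
  have "out_nbrs G a \<subseteq> pverts G" "in_nbrs G b \<subseteq> pverts G" "?F \<subseteq> parcs G"
    by (auto simp: out_nbrs_def in_nbrs_def edges_between_def dest: in_arcsD1 in_arcsD2)
  then have fin: "finite ?X" "finite ?Y" "finite ?F"
    using pair_finite_verts pair_finite_arcs by (auto intro: finite_subset)
  have S: "S C = ?P C" if "C \<in> components H" for C
  proof -
    have "verts C \<subseteq> ?X \<union> ?Y"
      using that unfolding components_def pre_digraph.max_subgraph_def subgraph_def V[symmetric] by simp
    then have "verts C - B = verts C \<inter> ?X" "verts C - A = verts C \<inter> ?Y"
      using X Y by auto
    \<comment> \<open>Among the out-neighbours of \<open>a\<close>, respectively the in-neighbours
      of \<open>b\<close>, the set prescribed for the other end is the complement of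
      \<open>?X\<close>, respectively \<open>?Y\<close>.\<close>
    then show ?thesis
      using ab unfolding assms(8)[OF that]
      by (auto simp: edges_between_def pendant_arcs_def)
  qed
  have rest: "?F \<inter> (- ?X) \<times> (- ?Y) =
      edges_between G (out_nbrs G a \<inter> (in_nbrs G b \<union> {b}))
        ((out_nbrs G a \<union> {a}) \<inter> in_nbrs G b)"
    by (auto simp: edges_between_def)
  have finS: "finite (S C)" if "C \<in> components H" for C
    using fin(3) unfolding S[OF that] by (rule finite_subset[rotated]) (auto simp: pendant_arcs_def)
  \<comment> \<open>The added 1 compensates the -1 exactly for empty \<open>S C\<close>; finiteness
    ensures that cardinality 0 means empty.\<close>
  have "(\<Sum>C\<in>components H. max 0 (int (card (S C)) - 1))
      = (\<Sum>C\<in>components H. int (card (S C)) + (if S C = {} then 1 else 0) - 1)"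
    using finS by (intro sum.cong) (auto simp: max_def card_gt_0_iff Suc_le_eq)
  also have "\<dots> = (\<Sum>C\<in>components H. int (card (S C)))
      + int (card {C \<in> components H. S C = {}}) - int t"
    using card_arcs_by_components(2)[OF V E fin]
    by (simp add: sum.distrib sum_subtractf assms(7) sum.inter_filter[symmetric])
  finally have max: "(\<Sum>C\<in>components H. max 0 (int (card (S C)) - 1))
      = int (\<Sum>C\<in>components H. card (?P C)) + int (card {C \<in> components H. ?P C = {}}) - int t"
    using S by (simp cong: conj_cong)
  \<comment> \<open>The dimension is \<open>card ?F\<close> minus the rank. The components with
    empty \<open>S C\<close> enter equally through the rank and through the sum of maxima, whose
    \<open>- int t\<close> cancels the \<open>t\<close> of the first bracket.\<close>
  show ?thesis
    using dim_Omega_3_from_to[OF assms(1-3), where 'k = 'k]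
      dim_span_arc_vectors[OF V E fin(1,2), where 'k = 'k]
      card_arcs_by_components(1)[OF V E fin]
    unfolding max rest V[symmetric] by linarith
qed

end
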